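(* Let $t\ge 1$ and let $V\subset\mathbb{R}^t$ be a variety defined by a system of $m\le t$ rational-function equations $f_1(\boldsymbol{x})=0,\dots,f_m(\boldsymbol{x})=0$ with integer coefficients, $\boldsymbol{x}=(x_1,\dots,x_t)$. Let $V(\mathbb{Z}_{>0})$ denote the set of points $\boldsymbol{n}=(n_1,\dots,n_t)$ with all $n_i$ positive integers lying on $V$. Say that $V$ satisfies Property (S) if the following holds: whenever $$\Big(\prod_p p^{\alpha_{1,p}},\dots,\prod_p p^{\alpha_{t,p}}\Big),\qquad \Big(\prod_p p^{\beta_{1,p}},\dots,\prod_p p^{\beta_{t,p}}\Big)$$ both lie in $V(\mathbb{Z}_{>0})$, then for every choice, made independently for each prime $p$, of $(\gamma_{1,p},\dots,\gamma_{t,p})\in\{(\alpha_{1,p},\dots,\alpha_{t,p}),(\beta_{1,p},\dots,\beta_{t,p})\}$, the point $\big(\prod_p p^{\gamma_{1,p}},\dots,\prod_p p^{\gamma_{t,p}}\big)$ also lies in $V(\mathbb{Z}_{>0})$. Then the following are equivalent: (i) for every multiplicative arithmetic function $a:\mathbb{Z}_{>0}^t\to\mathbb{C}$ (in the sense that $a(\boldsymbol{n})=\prod_p a(p^{v_p(n_1)},\dots,p^{v_p(n_t)})$), the twisted multiple Dirichlet series $$\sum_{\substack{n_1,\dots,n_t\ge 1\\ \boldsymbol{n}\in V(\mathbb{Z}_{>0})}}\frac{a(\boldsymbol{n})}{\prod_{i=1}^t n_i^{s_i}}$$ can be represented as an Euler product, i.e. there are sets $V_p\subset\mathbb{Z}_{\ge0}^t$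 (one for each prime $p$) such that the series equals $$\prod_p\ \sum_{(\alpha_1,\dots,\alpha_t)\in V_p}\frac{a(p^{\alpha_1},\dots,p^{\alpha_t})}{p^{\sum_{i=1}^t s_i\alpha_i}};$$ (ii) $V$ satisfies Property (S).
   Context: Here $p$ runs over primes, $v_p$ is the $p$-adic valuation, and the series and products are considered where they converge absolutely (e.g. for all $\Re s_i$ sufficiently large) or as formal identities. Property (S) is equivalent to saying that $V(\mathbb{Z}_{>0})$, viewed via exponent vectors, is a Cartesian product over primes $\prod_p V_p$ of sets of admissible exponent tuples. *)

theory Defs
  imports
    "HOL-Analysis.Analysis"
    "HOL-Computational_Algebra.Primes"
    "HOL-Library.Poly_Mapping"
begin

type_synonym 'n int_mpoly = "('n \<Rightarrow>\<^sub>0 nat) \<Rightarrow>\<^sub>0 int"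

definition mpoly_eval :: "'n::finite int_mpoly \<Rightarrow> real ^ 'n \<Rightarrow> real" where
  "mpoly_eval P x =
     (\<Sum>u\<in>Poly_Mapping.keys P. of_int (poly_mapping.lookup P u) * (\<Prod>i\<in>UNIV. (x $ i) ^ poly_mapping.lookup u i))"

text \<open>A rational function is a pair (numerator, denominator); it vanishes at a point if it is
  defined there, i.e. the denominator does not vanish, and the numerator vanishes.\<close>

type_synonym 'n ratfun = "'n int_mpoly \<times> 'n int_mpoly"

definition variety :: "'n::finite ratfun list \<Rightarrow> (real ^ 'n) set" where
  "variety fs = {x. \<forall>(P, Q)\<in>set fs. mpoly_eval Q x \<noteq> 0 \<and> mpoly_eval P x / mpoly_eval Q x = 0}"

definition pos_points :: "(real ^ 'n) set \<Rightarrow> (nat ^ 'n) set" where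
  "pos_points V = {n. (\<forall>i. n $ i > 0) \<and> (\<chi> i. real (n $ i)) \<in> V}"

text \<open>Families of exponent tuples are indexed by all natural numbers, but only the values at
  primes matter.\<close>

definition finite_exponents :: "(nat \<Rightarrow> nat ^ 'n) \<Rightarrow> bool" where
  "finite_exponents \<alpha> \<longleftrightarrow> finite {p. prime p \<and> \<alpha> p \<noteq> 0}"

definition exponent_point :: "(nat \<Rightarrow> nat ^ 'n) \<Rightarrow> nat ^ 'n" where
  "exponent_point \<alpha> = (\<chi> i. \<Prod>p\<in>{p. prime p \<and> \<alpha> p \<noteq> 0}. p ^ (\<alpha> p $ i))"

definition property_S :: "(real ^ 'n) set \<Rightarrow> bool" where
  "property_S V \<longleftrightarrow>
     (\<forall>\<alpha> \<beta>. finite_exponents \<alpha> \<and> finite_exponents \<beta> \<and>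
        exponent_point \<alpha> \<in> pos_points V \<and> exponent_point \<beta> \<in> pos_points V \<longrightarrow>
        (\<forall>\<gamma>. (\<forall>p. prime p \<longrightarrow> \<gamma> p \<in> {\<alpha> p, \<beta> p}) \<longrightarrow> exponent_point \<gamma> \<in> pos_points V))"

definition on_primes :: "(nat \<Rightarrow> complex) \<Rightarrow> nat \<Rightarrow> complex" where
  "on_primes f = (\<lambda>p. if prime p then f p else 1)"

definition prime_power_point :: "nat \<Rightarrow> nat ^ 'n \<Rightarrow> nat ^ 'n" where
  "prime_power_point p \<alpha> = (\<chi> i. p ^ (\<alpha> $ i))"

definition valuation :: "nat \<Rightarrow> nat ^ 'n \<Rightarrow> nat ^ 'n" where
  "valuation p n = (\<chi> i. multiplicity p (n $ i))"

text \<open>All but finitely many factors of the product are \<open>a(1,\<dots>,1)\<close>, so its convergence in the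
  sense of \<open>has_prod\<close> (nonzero limit up to finitely many zero factors) forces \<open>a(1,\<dots>,1) = 1\<close>,
  the usual normalisation of multiplicative functions.\<close>

definition multiplicative :: "(nat ^ 'n \<Rightarrow> complex) \<Rightarrow> bool" where
  "multiplicative a \<longleftrightarrow>
     (\<forall>n. (\<forall>i. n $ i > 0) \<longrightarrow>
        on_primes (\<lambda>p. a (prime_power_point p (valuation p n))) has_prod a n)"

definition dirichlet_term :: "(nat ^ 'n::finite \<Rightarrow> complex) \<Rightarrow> complex ^ 'n \<Rightarrow> nat ^ 'n \<Rightarrow> complex" where
  "dirichlet_term a s n = a n / (\<Prod>i\<in>UNIV. of_nat (n $ i) powr (s $ i))"

definition local_term ::
  "(nat ^ 'n::finite \<Rightarrow> complex) \<Rightarrow> complex ^ 'n \<Rightarrow> nat \<Rightarrow> nat ^ 'n \<Rightarrow> complex" where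
  "local_term a s p \<alpha> =
     a (prime_power_point p \<alpha>) / of_nat p powr (\<Sum>i\<in>UNIV. s $ i * of_nat (\<alpha> $ i))"

definition euler_factor ::
  "(nat ^ 'n::finite \<Rightarrow> complex) \<Rightarrow> complex ^ 'n \<Rightarrow> (nat \<Rightarrow> (nat ^ 'n) set) \<Rightarrow> nat \<Rightarrow> complex" where
  "euler_factor a s W p = (\<Sum>\<^sub>\<infinity>\<alpha>\<in>W p. local_term a s p \<alpha>)"

text \<open>Wherever the series over \<open>N\<close> converges absolutely, the local series and the Euler product
  converge absolutely and the product equals the series.\<close>

definition has_euler_product :: "(nat ^ 'n::finite \<Rightarrow> complex) \<Rightarrow> (nat ^ 'n) set \<Rightarrow> bool" where
  "has_euler_product a N \<longleftrightarrow>
     (\<exists>W :: nat \<Rightarrow> (nat ^ 'n) set. \<forall>s.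
        (\<lambda>n. norm (dirichlet_term a s n)) summable_on N \<longrightarrow>
          (\<forall>p. prime p \<longrightarrow> (\<lambda>\<alpha>. norm (local_term a s p \<alpha>)) summable_on W p) \<and>
          abs_convergent_prod (on_primes (euler_factor a s W)) \<and>
          on_primes (euler_factor a s W) has_prod (\<Sum>\<^sub>\<infinity>n\<in>N. dirichlet_term a s n))"

text \<open>A formal multiple Dirichlet series is given by its coefficient function on tuples of positive
  integers; multiplication is Dirichlet convolution, and an infinite product is the coefficientwise
  eventually constant limit of its partial products.\<close>

definition dirichlet_conv ::
  "(nat ^ 'n \<Rightarrow> complex) \<Rightarrow> (nat ^ 'n \<Rightarrow> complex) \<Rightarrow> nat ^ 'n \<Rightarrow> complex" where
  "dirichlet_conv c d n = (\<Sum>(k, l)\<in>{(k, l). \<forall>i. k $ i * l $ i = n $ i}. c k * d l)"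

definition formal_euler_factor ::
  "(nat ^ 'n \<Rightarrow> complex) \<Rightarrow> (nat \<Rightarrow> (nat ^ 'n) set) \<Rightarrow> nat \<Rightarrow> nat ^ 'n \<Rightarrow> complex" where
  "formal_euler_factor a W p n = (if n \<in> prime_power_point p ` W p then a n else 0)"

primrec formal_partial_prod :: "(nat \<Rightarrow> nat ^ 'n \<Rightarrow> complex) \<Rightarrow> nat \<Rightarrow> nat ^ 'n \<Rightarrow> complex" where
  "formal_partial_prod F 0 = (\<lambda>n. if n = (\<chi> i. 1) then 1 else 0)"
| "formal_partial_prod F (Suc N) =
     (if prime (Suc N) then dirichlet_conv (formal_partial_prod F N) (F (Suc N))
      else formal_partial_prod F N)"

definition has_formal_euler_product :: "(nat ^ 'n \<Rightarrow> complex) \<Rightarrow> (nat ^ 'n) set \<Rightarrow> bool" where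
  "has_formal_euler_product a N \<longleftrightarrow>
     (\<exists>W :: nat \<Rightarrow> (nat ^ 'n) set. \<forall>n. (\<forall>i. n $ i > 0) \<longrightarrow>
        (\<forall>\<^sub>F M in sequentially.
           formal_partial_prod (formal_euler_factor a W) M n = (if n \<in> N then a n else 0)))"

end

theory Submission
  imports Defs
begin

text \<open>Property (S) says that the set of positive points is an exponent box: membership is decided
  prime by prime. Given a box, the formal product is computed coefficientwise, and the analytic
  product is the usual rearrangement of an absolutely convergent series. If \<open>a\<close> does not vanish
  at some point \<open>n\<^sub>0\<close> of the box, then changing the exponents of \<open>n\<^sub>0\<close> at one prime embeds each
  local series (up to a nonzero factor) into the global one, which gives absolute convergence of
  the factors and of the product. Conversely, the formal product for \<open>a = 1\<close> exhibits the box
  directly, while the analytic products are tested at \<open>s = 0\<close> on multiplicative functions with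
  finite support whose values are distinct powers of \<open>2\<close>.\<close>

section \<open>Points, their exponent vectors and exponent boxes\<close>

definition prime_support :: "nat ^ 'n \<Rightarrow> nat set" where
  "prime_support n = {p. prime p \<and> valuation p n \<noteq> 0}"

text \<open>This is a restricted product of the sets \<open>W p\<close>: almost all valuations of a
  positive point vanish, so the box is empty unless \<open>0 \<in> W p\<close> for all but finitely
  many primes.\<close>

definition exponent_box :: "(nat \<Rightarrow> (nat ^ 'n) set) \<Rightarrow> (nat ^ 'n) set" where
  "exponent_box W = {n. (\<forall>i. n $ i > 0) \<and> (\<forall>p. prime p \<longrightarrow> valuation p n \<in> W p)}"

lemma prime_support_prime: "p \<in> prime_support n \<Longrightarrow> prime p"
  by (simp add: prime_support_def)

lemma finite_prime_support:
  assumes "\<forall>i. n $ i > 0"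
  shows "finite (prime_support n)"
proof (rule finite_subset)
  show "prime_support n \<subseteq> (\<Union>i\<in>UNIV. prime_factors (n $ i))"
    using assms by (auto simp: prime_support_def valuation_def vec_eq_iff prime_factors_multiplicity)
qed auto

lemma finite_exponents_valuation: "\<forall>i. n $ i > 0 \<Longrightarrow> finite_exponents (\<lambda>p. valuation p n)"
  using finite_prime_support by (simp add: finite_exponents_def prime_support_def)

lemma exponent_point_pos: "exponent_point \<alpha> $ i > 0"
  by (auto simp: exponent_point_def intro!: prod_pos dest: prime_gt_0_nat)

text \<open>Finiteness is essential: a product over an infinite index set is 1 by convention, which
  would erase the exponents.\<close>

lemma valuation_exponent_point:
  assumes "finite_exponents \<alpha>" "prime p"
  shows "valuation p (exponent_point \<alpha>) = \<alpha> p"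
proof -
  let ?S = "{p. prime p \<and> \<alpha> p \<noteq> 0}"
  have "multiplicity p (\<Prod>p\<in>?S. p ^ (\<alpha> p $ i)) = (if p \<in> ?S then \<alpha> p $ i else 0)" for i
    using assms by (intro multiplicity_prod_prime_powers) (auto simp: finite_exponents_def)
  with assms(2) show ?thesis
    by (simp add: valuation_def exponent_point_def vec_eq_iff[of _ "\<alpha> p"])
qed

text \<open>Unique factorization in each coordinate. Identities between points are reduced to
  identities between exponents in this way throughout.\<close>

lemma eq_of_valuations_eq:
  assumes "\<forall>i. m $ i > 0" "\<forall>i. n $ i > 0"
    and "\<And>p. prime p \<Longrightarrow> valuation p m = valuation p n"
  shows "m = n"
proof -
  have "m $ i = n $ i" for i
    by (rule multiplicity_eq_nat) (use assms in \<open>auto simp: valuation_def vec_eq_iff\<close>)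
  then show ?thesis by (simp add: vec_eq_iff)
qed

lemma exponent_point_valuation:
  "\<forall>i. n $ i > 0 \<Longrightarrow> exponent_point (\<lambda>p. valuation p n) = n"
  by (rule eq_of_valuations_eq)
     (auto simp: exponent_point_pos valuation_exponent_point finite_exponents_valuation)

lemma prime_power_point_pos: "prime p \<Longrightarrow> prime_power_point p \<alpha> $ i > 0"
  by (auto simp: prime_power_point_def dest: prime_gt_0_nat)

lemma valuation_prime_power_point:
  assumes "prime p" "prime q"
  shows "valuation q (prime_power_point p \<alpha>) = (if q = p then \<alpha> else 0)"
  using assms by (auto simp: valuation_def prime_power_point_def vec_eq_iff
      multiplicity_distinct_prime_power)

lemma prime_power_point_0: "prime_power_point p 0 = (\<chi> i. 1)"
  by (simp add: prime_power_point_def vec_eq_iff)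

lemma valuation_one: "valuation p (\<chi> i. 1) = 0"
  by (simp add: valuation_def vec_eq_iff)

text \<open>In a box the exponents at different primes are independent, which gives (S). Conversely
  \<open>W p\<close> collects the exponents occurring at \<open>p\<close> in some positive point;
  (S) mixes only two points at a time, but finitely many mixings suffice, since a point has only
  finitely many nonzero exponents.\<close>

lemma property_S_iff_exponent_box:
  fixes V :: "(real ^ 'n) set"
  shows "property_S V \<longleftrightarrow> (\<exists>W. pos_points V = exponent_box W)"
proof
  assume "\<exists>W. pos_points V = exponent_box W"
  then obtain W where W: "pos_points V = exponent_box W" ..
  show "property_S V"
    unfolding property_S_def W
  proof (intro allI impI, elim conjE)
    fix \<alpha> \<beta> \<gamma> :: "nat \<Rightarrow> nat ^ 'n"
    assume fin: "finite_exponents \<alpha>" "finite_exponents \<beta>"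
      and box: "exponent_point \<alpha> \<in> exponent_box W" "exponent_point \<beta> \<in> exponent_box W"
      and \<gamma>: "\<forall>p. prime p \<longrightarrow> \<gamma> p \<in> {\<alpha> p, \<beta> p}"
    have "{p. prime p \<and> \<gamma> p \<noteq> 0} \<subseteq> {p. prime p \<and> \<alpha> p \<noteq> 0} \<union> {p. prime p \<and> \<beta> p \<noteq> 0}"
      using \<gamma> by auto
    with fin have fin\<gamma>: "finite_exponents \<gamma>"
      unfolding finite_exponents_def by (meson finite_Un finite_subset)
    have "\<alpha> p \<in> W p \<and> \<beta> p \<in> W p" if "prime p" for p
      using box fin that by (auto simp: exponent_box_def valuation_exponent_point)
    with \<gamma> show "exponent_point \<gamma> \<in> exponent_box W"
      by (auto simp: exponent_box_def exponent_point_pos valuation_exponent_point fin\<gamma>)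
  qed
next
  assume S: "property_S V"
  let ?N = "pos_points V"
  define W where "W p = valuation p ` ?N" for p
  have pos: "\<forall>i. n $ i > 0" if "n \<in> ?N" for n
    using that by (simp add: pos_points_def)
  have glue: "exponent_point \<gamma> \<in> ?N"
    if "m \<in> ?N" "n \<in> ?N" "\<And>p. prime p \<Longrightarrow> \<gamma> p = valuation p m \<or> \<gamma> p = valuation p n" for m n \<gamma>
    using S[unfolded property_S_def, rule_format, of "\<lambda>p. valuation p m" "\<lambda>p. valuation p n" \<gamma>] that
    by (auto simp: finite_exponents_valuation exponent_point_valuation pos)
  have "n \<in> ?N" if n: "n \<in> exponent_box W" for n
  proof -
    have npos: "\<forall>i. n $ i > 0" using n by (simp add: exponent_box_def)
    \<comment> \<open>The prime 2 is an arbitrary choice: one nonempty \<open>W p\<close> already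
      provides a point of \<open>?N\<close> from which the exchanges can start.\<close>
    have "valuation 2 n \<in> W 2" using n by (simp add: exponent_box_def)
    then obtain m where m: "m \<in> ?N" by (auto simp: W_def)
    let ?B = "prime_support m \<union> prime_support n"
    \<comment> \<open>Only finitely many primes separate \<open>m\<close> from \<open>n\<close>; exchange them one at a time.\<close>
    have "\<exists>k\<in>?N. \<forall>p. prime p \<longrightarrow> valuation p k = (if p \<in> A then valuation p n else valuation p m)"
      if "finite A" "A \<subseteq> ?B" for A
      using that
    proof (induction A rule: finite_induct)
      case empty
      then show ?case using m by auto
    next
      case (insert q A)
      then obtain k where k: "k \<in> ?N"
        "\<And>p. prime p \<Longrightarrow> valuation p k = (if p \<in> A then valuation p n else valuation p m)"
        by auto
      have "prime q" using insert.prems by (auto simp: prime_support_def)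
      then have "valuation q n \<in> W q" using n by (simp add: exponent_box_def)
      then obtain l where l: "l \<in> ?N" "valuation q n = valuation q l" by (auto simp: W_def)
      \<comment> \<open>This mixes two points of \<open>?N\<close>: the exponents of
        \<open>k\<close> away from \<open>q\<close>, and those of \<open>l\<close> at
        \<open>q\<close>, where \<open>l\<close> agrees with \<open>n\<close>.\<close>
      define \<gamma> where "\<gamma> = (\<lambda>p. valuation p k)(q := valuation q n)"
      have "{p. prime p \<and> \<gamma> p \<noteq> 0} \<subseteq> insert q (prime_support k)"
        by (auto simp: \<gamma>_def prime_support_def)
      then have "finite_exponents \<gamma>"
        unfolding finite_exponents_def
        using finite_prime_support[OF pos[OF k(1)]] by (meson finite_insert finite_subset)
      moreover have "exponent_point \<gamma> \<in> ?N"
        using k(1) l(1) by (rule glue) (auto simp: \<gamma>_def l(2))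
      ultimately show ?case
        by (intro bexI[of _ "exponent_point \<gamma>"]) (auto simp: valuation_exponent_point \<gamma>_def k(2))
    qed
    from this[of ?B] obtain k where k: "k \<in> ?N"
      "\<And>p. prime p \<Longrightarrow> valuation p k = (if p \<in> ?B then valuation p n else valuation p m)"
      using finite_prime_support[OF pos[OF m]] finite_prime_support[OF npos] by auto
    have "k = n"
      by (rule eq_of_valuations_eq[OF pos[OF k(1)] npos]) (auto simp: k(2) prime_support_def)
    with k show ?thesis by simp
  qed
  moreover have "?N \<subseteq> exponent_box W"
    using pos by (auto simp: exponent_box_def W_def)
  ultimately have "?N = exponent_box W" by auto
  then show "\<exists>W. ?N = exponent_box W" by blast
qed

section \<open>Multiplicative functions as finite products over primes\<close>

text \<open>At \<open>(1,...,1)\<close> every prime contributes the same factor, and the factors of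
  a convergent product tend to 1.\<close>

lemma multiplicative_one:
  assumes "multiplicative a"
  shows "a (\<chi> i. 1) = 1"
proof -
  have "on_primes (\<lambda>p. a (\<chi> i. 1)) has_prod a (\<chi> i. 1)"
    using assms[unfolded multiplicative_def, rule_format, of "\<chi> i. 1"]
    by (simp add: valuation_one prime_power_point_0 del: One_nat_def)
  then have "on_primes (\<lambda>p. a (\<chi> i. 1)) \<longlonglongrightarrow> 1"
    by (intro convergent_prod_imp_LIMSEQ) (simp add: has_prod_iff)
  moreover have "infinite {p::nat. prime p}" by (rule primes_infinite)
  \<comment> \<open>At non-primes \<open>on_primes\<close> is 1 anyway, so the limit has to be taken
    along the infinite subsequence of primes.\<close>
  then have "strict_mono (enumerate {p::nat. prime p})" "\<And>k. prime (enumerate {p::nat. prime p} k)"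
    using enumerate_in_set strict_mono_enumerate by blast+
  ultimately have "(\<lambda>k. a (\<chi> i. 1)) \<longlonglongrightarrow> 1"
    using LIMSEQ_subseq_LIMSEQ[of "on_primes (\<lambda>p. a (\<chi> i. 1))" 1 "enumerate {p::nat. prime p}"]
    by (simp add: on_primes_def o_def)
  then show ?thesis by (simp add: LIMSEQ_const_iff)
qed

text \<open>Factors outside the support are \<open>a(1,...,1) = 1\<close>. Allowing any larger
  finite set \<open>P\<close> makes it possible to compare several points over one index
  set.\<close>

lemma multiplicative_eq_prod:
  assumes "multiplicative a" "\<forall>i. n $ i > 0" "finite P" "\<And>p. p \<in> P \<Longrightarrow> prime p" "prime_support n \<subseteq> P"
  shows "a n = (\<Prod>p\<in>P. a (prime_power_point p (valuation p n)))"
proof -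
  let ?f = "on_primes (\<lambda>p. a (prime_power_point p (valuation p n)))"
  have "?f has_prod (\<Prod>p\<in>P. ?f p)"
    using assms(3,5)
    by (intro has_prod_finite)
       (auto simp: on_primes_def prime_support_def prime_power_point_0 multiplicative_one[OF assms(1)]
         simp del: One_nat_def)
  moreover have "?f has_prod a n"
    using assms(1,2) by (simp add: multiplicative_def)
  moreover have "(\<Prod>p\<in>P. ?f p) = (\<Prod>p\<in>P. a (prime_power_point p (valuation p n)))"
    using assms(4) by (intro prod.cong) (auto simp: on_primes_def)
  ultimately show ?thesis using has_prod_unique2[of ?f] by simp
qed

lemma multiplicativeI:
  assumes "a (\<chi> i. 1) = 1"
    and "\<And>n. \<forall>i. n $ i > 0 \<Longrightarrow> a n = (\<Prod>p\<in>prime_support n. a (prime_power_point p (valuation p n)))"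
  shows "multiplicative a"
  unfolding multiplicative_def
proof (intro allI impI)
  fix n :: "nat ^ 'a"
  assume n: "\<forall>i. n $ i > 0"
  let ?f = "on_primes (\<lambda>p. a (prime_power_point p (valuation p n)))"
  have "?f has_prod (\<Prod>p\<in>prime_support n. ?f p)"
    using finite_prime_support[OF n] assms(1)
    by (intro has_prod_finite) (auto simp: on_primes_def prime_support_def prime_power_point_0)
  also have "(\<Prod>p\<in>prime_support n. ?f p) = a n"
    by (subst assms(2)[OF n], intro prod.cong) (auto simp: on_primes_def prime_support_def)
  finally show "?f has_prod a n" .
qed

lemma prime_support_prime_power_point:
  "prime p \<Longrightarrow> prime_support (prime_power_point p \<alpha>) = (if \<alpha> = 0 then {} else {p})"
  by (auto simp: prime_support_def valuation_prime_power_point split: if_splits)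

text \<open>A multiplicative function can be prescribed freely at the nontrivial prime powers. This
  supplies the test function for the analytic converse.\<close>

lemma multiplicative_prod_prime_support:
  assumes "\<And>p. prime p \<Longrightarrow> b p 0 = 1"
  defines "a \<equiv> \<lambda>n. \<Prod>p\<in>prime_support n. b p (valuation p n)"
  shows "multiplicative a" and "prime p \<Longrightarrow> a (prime_power_point p \<alpha>) = b p \<alpha>"
proof -
  have *: "a (prime_power_point p \<alpha>) = b p \<alpha>" if "prime p" for p \<alpha>
    using that assms(1)
    by (auto simp: a_def prime_support_prime_power_point valuation_prime_power_point)
  show "multiplicative a"
  proof (rule multiplicativeI)
    show "a (\<chi> i. 1) = 1" by (simp add: a_def prime_support_def valuation_one del: One_nat_def)
    show "a n = (\<Prod>p\<in>prime_support n. a (prime_power_point p (valuation p n)))" for n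
      unfolding a_def by (intro prod.cong refl *[unfolded a_def, symmetric]) (rule prime_support_prime)
  qed
  show "a (prime_power_point p \<alpha>) = b p \<alpha>" if "prime p" using * that .
qed

section \<open>Changing the exponents at a single prime\<close>

definition replace_exponent :: "nat \<Rightarrow> nat ^ 'n \<Rightarrow> nat ^ 'n \<Rightarrow> nat ^ 'n" where
  "replace_exponent q \<alpha> n = exponent_point ((\<lambda>p. valuation p n)(q := \<alpha>))"

lemma replace_exponent_pos: "replace_exponent q \<alpha> n $ i > 0"
  by (simp add: replace_exponent_def exponent_point_pos)

lemma valuation_replace_exponent:
  assumes "\<forall>i. n $ i > 0" "prime p"
  shows "valuation p (replace_exponent q \<alpha> n) = (if p = q then \<alpha> else valuation p n)"
proof -
  let ?\<gamma> = "(\<lambda>p. valuation p n)(q := \<alpha>)"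
  have "{p. prime p \<and> ?\<gamma> p \<noteq> 0} \<subseteq> insert q (prime_support n)"
    by (auto simp: prime_support_def)
  then have "finite_exponents ?\<gamma>"
    unfolding finite_exponents_def
    using finite_prime_support[OF assms(1)] by (meson finite_insert finite_subset)
  then show ?thesis
    using assms(2) by (simp add: replace_exponent_def valuation_exponent_point)
qed

lemma replace_exponent_valuation:
  assumes "\<forall>i. n $ i > 0"
  shows "replace_exponent q (valuation q n) n = n"
  by (rule eq_of_valuations_eq)
     (use assms in \<open>auto simp: replace_exponent_pos valuation_replace_exponent\<close>)

text \<open>Only the factor at \<open>q\<close> depends on \<alpha>, and with exponent 0 that factor
  is 1. The remaining factors are thus a value of \<open>a\<close> themselves, and no division by a
  possibly vanishing factor occurs.\<close>

lemma multiplicative_replace_exponent: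
  assumes "multiplicative a" "\<forall>i. n $ i > 0" "prime q"
  shows "a (replace_exponent q \<alpha> n) = a (prime_power_point q \<alpha>) * a (replace_exponent q 0 n)"
proof -
  let ?P = "insert q (prime_support n)"
  have P: "finite ?P" "q \<in> ?P" "\<And>p. p \<in> ?P \<Longrightarrow> prime p"
    using assms finite_prime_support[OF assms(2)] by (auto dest: prime_support_prime)
  have eq: "a (replace_exponent q \<beta> n) =
      a (prime_power_point q \<beta>) * (\<Prod>p\<in>?P - {q}. a (prime_power_point p (valuation p n)))" for \<beta>
  proof -
    have "a (replace_exponent q \<beta> n) =
        (\<Prod>p\<in>?P. a (prime_power_point p (valuation p (replace_exponent q \<beta> n))))"
    proof (rule multiplicative_eq_prod[OF assms(1) _ P(1,3)])
      show "prime_support (replace_exponent q \<beta> n) \<subseteq> ?P"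
        using assms(2) by (auto simp: prime_support_def valuation_replace_exponent split: if_splits)
    qed (auto simp: replace_exponent_pos)
    also have "\<dots> = (\<Prod>p\<in>?P. a (prime_power_point p (if p = q then \<beta> else valuation p n)))"
      by (intro prod.cong refl) (simp add: valuation_replace_exponent[OF assms(2) P(3)])
    also have "\<dots> = a (prime_power_point q \<beta>) *
        (\<Prod>p\<in>?P - {q}. a (prime_power_point p (if p = q then \<beta> else valuation p n)))"
      using P by (subst prod.remove[of _ q]) auto
    also have "(\<Prod>p\<in>?P - {q}. a (prime_power_point p (if p = q then \<beta> else valuation p n))) =
        (\<Prod>p\<in>?P - {q}. a (prime_power_point p (valuation p n)))"
      by (intro prod.cong) auto
    finally show ?thesis .
  qed
  show ?thesis
    unfolding eq[of \<alpha>] eq[of 0]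
    by (simp add: prime_power_point_0 multiplicative_one[OF assms(1)] del: One_nat_def)
qed

section \<open>Formal Euler products, coefficient by coefficient\<close>

lemma valuation_mult:
  assumes "\<forall>i. k $ i * l $ i = n $ i" "\<forall>i. n $ i > 0" "prime p"
  shows "valuation p n = valuation p k + valuation p l"
proof -
  have "multiplicity p (n $ i) = multiplicity p (k $ i) + multiplicity p (l $ i)" for i
  proof -
    have "k $ i * l $ i = n $ i" "n $ i > 0" using assms by auto
    then have "k $ i \<noteq> 0" "l $ i \<noteq> 0" by (metis mult_is_0 less_not_refl)+
    with assms(3) have "multiplicity p (k $ i * l $ i) = multiplicity p (k $ i) + multiplicity p (l $ i)"
      by (intro prime_elem_multiplicity_mult_distrib) auto
    then show ?thesis by (simp add: \<open>k $ i * l $ i = n $ i\<close>)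
  qed
  then show ?thesis by (simp add: valuation_def vec_eq_iff)
qed

lemma finite_factorizations:
  fixes n :: "nat ^ 'n"
  assumes "\<forall>i. n $ i > 0"
  shows "finite {(k, l). \<forall>i. k $ i * l $ i = n $ i}"
proof -
  let ?D = "vec_lambda ` (\<Pi>\<^sub>E i\<in>UNIV. {..n $ i}) :: (nat ^ 'n) set"
  have D: "k \<in> ?D" if "\<And>i. k $ i \<le> n $ i" for k :: "nat ^ 'n"
    using that by (intro image_eqI[of _ _ "vec_nth k"]) auto
  have "k $ i \<le> n $ i \<and> l $ i \<le> n $ i" if "\<forall>i. k $ i * l $ i = n $ i" for k l i
  proof -
    have "k $ i * l $ i = n $ i" "n $ i > 0" using that assms by auto
    then show ?thesis by (metis dvd_imp_le dvd_triv_left dvd_triv_right)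
  qed
  then have "{(k, l). \<forall>i. k $ i * l $ i = n $ i} \<subseteq> ?D \<times> ?D"
    by (auto intro!: D)
  moreover have "finite ?D" by (intro finite_imageI finite_PiE) auto
  ultimately show ?thesis by (meson finite_SigmaI finite_subset)
qed

text \<open>Induction on \<open>M\<close>. Convolving with the factor at a new prime
  \<open>q\<close> picks out a single factorization of \<open>n\<close>, into its
  \<open>q\<close>-part \<open>l0\<close> and its \<open>q\<close>-free part \<open>k0\<close>. The
  set \<open>{0}\<close> stands at the primes that have not been multiplied in yet.\<close>

lemma formal_partial_prod_eq:
  fixes W :: "nat \<Rightarrow> (nat ^ 'n) set"
  assumes "multiplicative a" "\<forall>i. n $ i > 0"
  shows "formal_partial_prod (formal_euler_factor a W) M n =
    (if n \<in> exponent_box (\<lambda>p. if p \<le> M then W p else {0}) then a n else 0)"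
  using assms(2)
proof (induction M arbitrary: n)
  case 0
  have "n = (\<chi> i. 1)" if "\<forall>p. prime p \<longrightarrow> valuation p n = 0"
    by (rule eq_of_valuations_eq) (use 0 that in \<open>auto simp: valuation_one simp del: One_nat_def\<close>)
  then have "n \<in> exponent_box (\<lambda>p. if p \<le> 0 then W p else {0}) \<longleftrightarrow> n = (\<chi> i. 1)"
    using 0 by (auto simp: exponent_box_def valuation_one simp del: One_nat_def)
  then show ?case
    by (auto simp: multiplicative_one[OF assms(1)] simp del: One_nat_def)
next
  case (Suc M)
  show ?case
  proof (cases "prime (Suc M)")
    case False
    then have "exponent_box (\<lambda>p. if p \<le> Suc M then W p else {0}) =
        exponent_box (\<lambda>p. if p \<le> M then W p else {0})"
      unfolding exponent_box_def by (metis le_Suc_eq)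
    with False show ?thesis by (simp add: Suc)
  next
    case True
    define q where "q = Suc M"
    have q: "prime q" using True by (simp add: q_def)
    define c where "c = formal_partial_prod (formal_euler_factor a W) M"
    define d where "d = formal_euler_factor a W q"
    define k0 where "k0 = replace_exponent q 0 n"
    define l0 where "l0 = prime_power_point q (valuation q n)"
    let ?S = "{(k, l). \<forall>i. k $ i * l $ i = n $ i}"
    have vk0: "valuation p k0 = (if p = q then 0 else valuation p n)" if "prime p" for p
      using that Suc.prems by (simp add: k0_def valuation_replace_exponent)
    have pos0: "\<forall>i. k0 $ i > 0" "\<forall>i. l0 $ i > 0"
      using q by (auto simp: k0_def l0_def replace_exponent_pos prime_power_point_pos)
    have c_eq: "c k = (if k \<in> exponent_box (\<lambda>p. if p \<le> M then W p else {0}) then a k else 0)"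
      if "\<forall>i. k $ i > 0" for k
      using Suc.IH that by (simp add: c_def)
    have "valuation p (\<chi> i. k0 $ i * l0 $ i) = valuation p n" if "prime p" for p
      by (subst valuation_mult[of k0 l0])
         (use that pos0 q in \<open>auto simp: vk0 l0_def valuation_prime_power_point\<close>)
    then have "(\<chi> i. k0 $ i * l0 $ i) = n"
      using pos0 Suc.prems by (intro eq_of_valuations_eq[of "\<chi> i. k0 $ i * l0 $ i"]) auto
    then have S0: "(k0, l0) \<in> ?S" by (auto simp: vec_eq_iff)
    \<comment> \<open>If \<open>d l\<close> is nonzero then \<open>l\<close> is a power of
      \<open>q\<close> in each coordinate; if \<open>c k\<close> is nonzero then \<open>q\<close>
      divides no coordinate of \<open>k\<close>. The valuations of \<open>n\<close> then determine
      both.\<close>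
    have unique: "(k, l) = (k0, l0)" if S: "(k, l) \<in> ?S" and nz: "c k * d l \<noteq> 0" for k l
    proof -
      have "k $ i > 0 \<and> l $ i > 0" for i
      proof -
        have "k $ i * l $ i = n $ i" "n $ i > 0" using S Suc.prems by auto
        then show ?thesis by (metis nat_0_less_mult_iff)
      qed
      then have pos: "\<forall>i. k $ i > 0" "\<forall>i. l $ i > 0" by auto
      from nz obtain \<delta> where l: "l = prime_power_point q \<delta>"
        by (auto simp: d_def formal_euler_factor_def split: if_splits)
      have "valuation q k = 0"
        using nz c_eq[OF pos(1)] q by (auto simp: exponent_box_def q_def split: if_splits)
      then have "valuation q n = \<delta>"
        using valuation_mult[of k l n q] S Suc.prems q by (auto simp: l valuation_prime_power_point)
      then have l': "l = l0" by (simp add: l l0_def)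
      moreover have "k = k0"
      proof (rule eq_of_valuations_eq[OF pos(1) pos0(1)])
        fix p :: nat assume p: "prime p"
        then show "valuation p k = valuation p k0"
          using valuation_mult[of k l n p] S Suc.prems q \<open>valuation q k = 0\<close>
          by (auto simp: vk0 l valuation_prime_power_point)
      qed
      ultimately show ?thesis by simp
    qed
    have "formal_partial_prod (formal_euler_factor a W) (Suc M) n = dirichlet_conv c d n"
      using True by (simp add: c_def d_def q_def)
    also have "\<dots> = (\<Sum>(k, l)\<in>?S. c k * d l)"
      by (simp add: dirichlet_conv_def)
    also have "\<dots> = (\<Sum>(k, l)\<in>{(k0, l0)}. c k * d l)"
    proof (rule sum.mono_neutral_right)
      show "finite ?S" by (rule finite_factorizations[OF Suc.prems])
      show "{(k0, l0)} \<subseteq> ?S" using S0 by (simp del: mem_Collect_eq)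
      show "\<forall>x\<in>?S - {(k0, l0)}. (case x of (k, l) \<Rightarrow> c k * d l) = 0"
      proof
        fix x assume x: "x \<in> ?S - {(k0, l0)}"
        obtain k l where kl: "x = (k, l)" by (cases x)
        have "(k, l) \<in> ?S" "(k, l) \<noteq> (k0, l0)"
          using x unfolding kl by (rule DiffD1, blast)
        then have "c k * d l = 0" using unique by blast
        then show "(case x of (k, l) \<Rightarrow> c k * d l) = 0" by (simp add: kl)
      qed
    qed
    also have "\<dots> = c k0 * d l0" by simp
    also have "d l0 = (if valuation q n \<in> W q then a l0 else 0)"
    proof -
      have "\<alpha> = \<beta>" if "prime_power_point q \<alpha> = prime_power_point q \<beta>" for \<alpha> \<beta> :: "nat ^ 'n"
        using that valuation_prime_power_point[OF q q] by metis
      then have "l0 \<in> prime_power_point q ` W q \<longleftrightarrow> valuation q n \<in> W q"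
        unfolding l0_def by blast
      then show ?thesis by (simp add: d_def formal_euler_factor_def)
    qed
    also have "c k0 * \<dots> =
        (if k0 \<in> exponent_box (\<lambda>p. if p \<le> M then W p else {0}) \<and> valuation q n \<in> W q
         then a l0 * a k0 else 0)"
      by (simp add: c_eq[OF pos0(1)])
    \<comment> \<open>Replacing the exponent of \<open>n\<close> at \<open>q\<close> by itself gives
      back \<open>n\<close>, so this is the splitting off of the factor at \<open>q\<close>.\<close>
    also have "a l0 * a k0 = a n"
      using multiplicative_replace_exponent[OF assms(1) Suc.prems q, of "valuation q n"]
      by (simp add: replace_exponent_valuation[OF Suc.prems] k0_def l0_def)
    also have "k0 \<in> exponent_box (\<lambda>p. if p \<le> M then W p else {0}) \<and> valuation q n \<in> W q
        \<longleftrightarrow> n \<in> exponent_box (\<lambda>p. if p \<le> Suc M then W p else {0})"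
      using Suc.prems pos0(1) q
      by (auto simp: exponent_box_def vk0 q_def le_Suc_eq split: if_splits)
    finally show ?thesis .
  qed
qed

lemma valuation_zero_above:
  assumes "\<forall>i. n $ i > 0"
  obtains M where "\<And>p. prime p \<Longrightarrow> p > M \<Longrightarrow> valuation p n = 0"
proof -
  obtain M where "\<forall>p\<in>prime_support n. p \<le> M"
    using finite_prime_support[OF assms] unfolding finite_nat_set_iff_bounded_le ..
  then have "valuation p n = 0" if "prime p" "p > M" for p
    using that by (auto simp: prime_support_def)
  then show thesis by (rule that)
qed

lemma in_truncated_exponent_box:
  assumes "n \<in> exponent_box W" "\<And>p. prime p \<Longrightarrow> p > M \<Longrightarrow> valuation p n = 0"
  shows "n \<in> exponent_box (\<lambda>p. if p \<le> M then W p else {0})"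
  using assms by (simp add: exponent_box_def not_le)

text \<open>For a point of the box it suffices that \<open>M\<close> passes all primes in its
  support. Any other point has an inadmissible exponent at some prime and is excluded once
  \<open>M\<close> reaches that prime.\<close>

lemma formal_partial_prod_eventually:
  assumes "multiplicative a" "\<forall>i. n $ i > 0"
  shows "\<forall>\<^sub>F M in sequentially. formal_partial_prod (formal_euler_factor a W) M n =
    (if n \<in> exponent_box W then a n else 0)"
proof -
  obtain M0 where M0: "\<And>p. prime p \<Longrightarrow> p > M0 \<Longrightarrow> valuation p n = 0"
    by (rule valuation_zero_above[OF assms(2)]) blast
  show ?thesis
  proof (cases "n \<in> exponent_box W")
    case True
    have "n \<in> exponent_box (\<lambda>p. if p \<le> M then W p else {0})" if "M \<ge> M0" for M
      by (rule in_truncated_exponent_box[OF True M0]) (use that in auto)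
    with True show ?thesis
      by (intro eventually_sequentiallyI[of M0]) (simp add: formal_partial_prod_eq[OF assms])
  next
    case False
    then obtain p where "prime p" "valuation p n \<notin> W p"
      using assms(2) by (auto simp: exponent_box_def)
    then have "n \<notin> exponent_box (\<lambda>p. if p \<le> M then W p else {0})" if "M \<ge> p" for M
      using that by (auto simp: exponent_box_def)
    with False show ?thesis
      by (intro eventually_sequentiallyI[of p]) (simp add: formal_partial_prod_eq[OF assms])
  qed
qed

lemma has_formal_euler_product_exponent_box:
  "multiplicative a \<Longrightarrow> has_formal_euler_product a (exponent_box W)"
  unfolding has_formal_euler_product_def using formal_partial_prod_eventually by blast

lemma multiplicative_const_1: "multiplicative (\<lambda>_. 1)"
  by (simp add: multiplicative_def on_primes_def)

text \<open>For \<open>a = 1\<close> the indicators of \<open>N\<close> and of the box are both the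
  eventual values of the same partial products, hence equal.\<close>

lemma exponent_box_of_formal_euler_product:
  assumes "has_formal_euler_product (\<lambda>_. 1) N" "\<And>n. n \<in> N \<Longrightarrow> \<forall>i. n $ i > 0"
  shows "\<exists>W. N = exponent_box W"
proof -
  from assms(1) obtain W where W: "\<And>n. \<forall>i. n $ i > 0 \<Longrightarrow> \<forall>\<^sub>F M in sequentially.
      formal_partial_prod (formal_euler_factor (\<lambda>_. 1) W) M n = (if n \<in> N then 1 else 0)"
    unfolding has_formal_euler_product_def by auto
  have "n \<in> N \<longleftrightarrow> n \<in> exponent_box W" if n: "\<forall>i. n $ i > 0" for n
  proof -
    have "\<forall>\<^sub>F M in sequentially. (if n \<in> N then 1 else 0 :: complex) = (if n \<in> exponent_box W then 1 else 0)"
      using W[OF n] formal_partial_prod_eventually[OF multiplicative_const_1 n, of W]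
      by eventually_elim simp
    then show ?thesis by (simp split: if_splits)
  qed
  then have "N = exponent_box W"
    using assms(2) by (auto simp: exponent_box_def)
  then show ?thesis by blast
qed

section \<open>Sums over exhausting sets and over finitely many primes\<close>

lemma infsum_split_subset:
  fixes f :: "'a \<Rightarrow> 'b::banach"
  assumes "f summable_on A" "B \<subseteq> A"
  shows "infsum f A = infsum f B + infsum f (A - B)"
  using infsum_Un_disjoint[of f B "A - B"] assms
  by (auto simp: Un_absorb1 intro: summable_on_subset_banach)

text \<open>A finite \<open>X\<close> carries all but \<open>e / 2\<close> of the absolute sum, and
  once \<open>B M\<close> contains \<open>X\<close> the missing terms lie in \<open>A - X\<close>.
  Inclusion in \<open>A\<close> is asked only eventually because truncated boxes may stick out at
  first: exponent 0 need not be admissible at small primes.\<close>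

lemma infsum_exhaustion_tendsto:
  fixes f :: "'a \<Rightarrow> 'b::banach"
  assumes f: "(\<lambda>x. norm (f x)) summable_on A"
    and sub: "\<forall>\<^sub>F M in F. B M \<subseteq> A"
    and exh: "\<And>x. x \<in> A \<Longrightarrow> \<forall>\<^sub>F M in F. x \<in> B M"
  shows "((\<lambda>M. infsum f (B M)) \<longlongrightarrow> infsum f A) F"
proof (rule tendstoI)
  fix e :: real assume "e > 0"
  then obtain X where X: "finite X" "X \<subseteq> A"
    "dist (\<Sum>x\<in>X. norm (f x)) (\<Sum>\<^sub>\<infinity>x\<in>A. norm (f x)) \<le> e / 2"
    using infsum_finite_approximation[OF f, of "e / 2"] by auto
  have "\<forall>\<^sub>F M in F. \<forall>x\<in>X. x \<in> B M"
    using X exh by (intro eventually_ball_finite) auto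
  with sub show "\<forall>\<^sub>F M in F. dist (infsum f (B M)) (infsum f A) < e"
  proof eventually_elim
    case (elim M)
    have "norm (infsum f (A - B M)) \<le> (\<Sum>\<^sub>\<infinity>x\<in>A - B M. norm (f x))"
      by (intro norm_infsum_bound summable_on_subset_banach[OF f]) auto
    also have "\<dots> \<le> (\<Sum>\<^sub>\<infinity>x\<in>A - X. norm (f x))"
      using elim by (intro infsum_mono2 summable_on_subset_banach[OF f]) auto
    also have "\<dots> = (\<Sum>\<^sub>\<infinity>x\<in>A. norm (f x)) - (\<Sum>x\<in>X. norm (f x))"
      using infsum_split_subset[OF f X(2)] X(1) by simp
    also have "\<dots> < e"
      using X(3) \<open>e > 0\<close> unfolding dist_real_def by linarith
    finally have "norm (infsum f (A - B M)) < e" .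
    moreover have "infsum f A = infsum f (B M) + infsum f (A - B M)"
      by (rule infsum_split_subset[OF abs_summable_summable[OF f] elim(1)])
    ultimately show ?case by (simp add: dist_norm norm_minus_commute)
  qed
qed

text \<open>Points of the box correspond to choice functions in \<open>PiE P W\<close>, and
  \<open>f\<close> is a product over \<open>P\<close> at such a point. The identity is the
  distributive law for absolutely convergent sums.\<close>

lemma infsum_exponent_box_finite:
  fixes W :: "nat \<Rightarrow> (nat ^ 'n) set"
  assumes "multiplicative f" "finite P" "\<And>p. p \<in> P \<Longrightarrow> prime p"
    and "\<And>p. p \<in> P \<Longrightarrow> (\<lambda>\<alpha>. norm (f (prime_power_point p \<alpha>))) summable_on W p"
  shows "infsum f (exponent_box (\<lambda>p. if p \<in> P then W p else {0})) =
    (\<Prod>p\<in>P. \<Sum>\<^sub>\<infinity>\<alpha>\<in>W p. f (prime_power_point p \<alpha>))"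
proof -
  define pt :: "(nat \<Rightarrow> nat ^ 'n) \<Rightarrow> nat ^ 'n"
    where "pt h = exponent_point (\<lambda>p. if p \<in> P then h p else 0)" for h
  let ?B = "exponent_box (\<lambda>p. if p \<in> P then W p else {0})"
  have pos: "\<forall>i. pt h $ i > 0" for h by (simp add: pt_def exponent_point_pos)
  have val: "valuation p (pt h) = (if p \<in> P then h p else 0)" if "prime p" for p h
  proof -
    have "{p. prime p \<and> (if p \<in> P then h p else 0) \<noteq> 0} \<subseteq> P" by auto
    then have "finite_exponents (\<lambda>p. if p \<in> P then h p else 0)"
      unfolding finite_exponents_def using assms(2) finite_subset by blast
    then show ?thesis using that by (simp add: pt_def valuation_exponent_point)
  qed
  have "bij_betw pt (PiE P W) ?B"
  proof (rule bij_betw_byWitness[where f' = "\<lambda>n. restrict (\<lambda>p. valuation p n) P"])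
    show "\<forall>h\<in>PiE P W. restrict (\<lambda>p. valuation p (pt h)) P = h"
      using assms(3) by (auto simp: val fun_eq_iff restrict_def PiE_def extensional_def)
    show "\<forall>n\<in>?B. pt (restrict (\<lambda>p. valuation p n) P) = n"
    proof
      fix n assume n: "n \<in> ?B"
      show "pt (restrict (\<lambda>p. valuation p n) P) = n"
        by (rule eq_of_valuations_eq[OF pos]) (use n in \<open>auto simp: val exponent_box_def split: if_splits\<close>)
    qed
    show "pt ` PiE P W \<subseteq> ?B"
      by (auto simp: exponent_box_def pos val)
    show "(\<lambda>n. restrict (\<lambda>p. valuation p n) P) ` ?B \<subseteq> PiE P W"
    proof (rule image_subsetI)
      fix n assume n: "n \<in> ?B"
      have "valuation p n \<in> W p" if "p \<in> P" for p
        using n that assms(3)[OF that] unfolding exponent_box_def by auto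
      then show "restrict (\<lambda>p. valuation p n) P \<in> PiE P W" by simp
    qed
  qed
  then have "infsum f ?B = (\<Sum>\<^sub>\<infinity>h\<in>PiE P W. f (pt h))"
    by (rule infsum_reindex_bij_betw[symmetric])
  also have "\<dots> = (\<Sum>\<^sub>\<infinity>h\<in>PiE P W. \<Prod>p\<in>P. f (prime_power_point p (h p)))"
  proof (rule infsum_cong)
    fix h
    have "f (pt h) = (\<Prod>p\<in>P. f (prime_power_point p (valuation p (pt h))))"
    proof (rule multiplicative_eq_prod[OF assms(1) pos assms(2,3)])
      show "prime_support (pt h) \<subseteq> P"
        by (auto simp: prime_support_def val split: if_splits)
    qed
    then show "f (pt h) = (\<Prod>p\<in>P. f (prime_power_point p (h p)))"
      by (simp add: val[OF assms(3)])
  qed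
  also have "\<dots> = (\<Prod>p\<in>P. \<Sum>\<^sub>\<infinity>\<alpha>\<in>W p. f (prime_power_point p \<alpha>))"
    by (rule infsum_prod_PiE_abs[OF assms(2,4)])
  finally show ?thesis .
qed

section \<open>Convergence and value of the analytic Euler product\<close>

lemma replace_exponent_in_exponent_box:
  assumes "n \<in> exponent_box W" "\<alpha> \<in> W p"
  shows "replace_exponent p \<alpha> n \<in> exponent_box W"
  using assms by (auto simp: exponent_box_def replace_exponent_pos valuation_replace_exponent)

context
  fixes f :: "nat ^ 'n \<Rightarrow> complex" and W :: "nat \<Rightarrow> (nat ^ 'n) set" and n0 :: "nat ^ 'n"
  assumes mult: "multiplicative f" and n0: "n0 \<in> exponent_box W" "f n0 \<noteq> 0"
    and summable: "(\<lambda>n. norm (f n)) summable_on exponent_box W"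
begin

private lemma n0_pos: "\<forall>i. n0 $ i > 0"
  using n0(1) by (simp add: exponent_box_def)

text \<open>Varying the exponent of \<open>n0\<close> at \<open>p\<close> yields distinct points of
  the box, whose terms are those of the local series times \<open>?K\<close>. Since
  \<open>?K\<close> is a factor of \<open>f n0\<close>, it is nonzero and can be cancelled.\<close>

lemma summable_local_factor:
  assumes p: "prime p"
  shows "(\<lambda>\<alpha>. norm (f (prime_power_point p \<alpha>))) summable_on W p"
proof -
  let ?K = "f (replace_exponent p 0 n0)"
  have "f n0 = f (prime_power_point p (valuation p n0)) * ?K"
    using multiplicative_replace_exponent[OF mult n0_pos p, of "valuation p n0"]
    by (simp add: replace_exponent_valuation[OF n0_pos])
  with n0(2) have K: "norm ?K \<noteq> 0" by auto
  have "inj_on (\<lambda>\<alpha>. replace_exponent p \<alpha> n0) (W p)"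
    by (rule inj_on_inverseI[where g = "valuation p"]) (simp add: valuation_replace_exponent n0_pos p)
  moreover have "(\<lambda>\<alpha>. replace_exponent p \<alpha> n0) ` W p \<subseteq> exponent_box W"
    using replace_exponent_in_exponent_box[OF n0(1)] by auto
  ultimately have "(\<lambda>\<alpha>. norm (f (replace_exponent p \<alpha> n0))) summable_on W p"
    using summable_on_subset_banach[OF summable, of "(\<lambda>\<alpha>. replace_exponent p \<alpha> n0) ` W p"]
    by (simp add: summable_on_reindex o_def)
  then have "(\<lambda>\<alpha>. norm (f (prime_power_point p \<alpha>)) * norm ?K) summable_on W p"
    by (subst (asm) multiplicative_replace_exponent[OF mult n0_pos p]) (simp add: norm_mult)
  with K show ?thesis by (simp add: summable_on_cmult_left')
qed

text \<open>For a prime \<open>p\<close> outside the support of \<open>n0\<close> the exponent 0 is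
  admissible and contributes 1, so \<open>?E p - 1\<close> is the sum over the nonzero exponents.
  Inserting a nonzero exponent at such a prime into \<open>n0\<close> reaches each point at most
  once, so all these tails are summable together.\<close>

lemma abs_convergent_local_factors:
  "abs_convergent_prod (on_primes (\<lambda>p. \<Sum>\<^sub>\<infinity>\<alpha>\<in>W p. f (prime_power_point p \<alpha>)))"
proof -
  let ?E = "\<lambda>p. \<Sum>\<^sub>\<infinity>\<alpha>\<in>W p. f (prime_power_point p \<alpha>)"
  let ?Q = "{p. prime p \<and> p \<notin> prime_support n0}"
  \<comment> \<open>Exponent 0 is left out because every pair \<open>(p, 0)\<close> would be sent to
    \<open>n0\<close> itself, and \<open>?h\<close> would not be injective.\<close>
  let ?D = "Sigma ?Q (\<lambda>p. W p - {0})"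
  let ?h = "\<lambda>(p, \<alpha>). replace_exponent p \<alpha> n0"
  have Q: "valuation p n0 = 0" "prime p" if "p \<in> ?Q" for p
    using that by (auto simp: prime_support_def)
  have inj: "inj_on ?h ?D"
  proof (rule inj_onI)
    fix x y assume x: "x \<in> ?D" and y: "y \<in> ?D" and eq: "?h x = ?h y"
    obtain p \<alpha> where xp: "x = (p, \<alpha>)" "p \<in> ?Q" "\<alpha> \<noteq> 0" using x by blast
    obtain q \<beta> where yq: "y = (q, \<beta>)" using y by blast
    have "(if p = q then \<beta> else valuation p n0) = \<alpha>"
      using arg_cong[OF eq, of "valuation p"] Q(2)[OF xp(2)]
      by (simp add: valuation_replace_exponent n0_pos xp(1) yq)
    then show "x = y" using xp yq Q(1)[OF xp(2)] by (auto split: if_splits)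
  qed
  have "?h ` ?D \<subseteq> exponent_box W"
    using replace_exponent_in_exponent_box[OF n0(1)] by auto
  then have "(\<lambda>x. norm (f (?h x))) summable_on ?D"
    using summable_on_subset_banach[OF summable, of "?h ` ?D"] summable_on_reindex[OF inj, of "\<lambda>n. norm (f n)"]
    by (simp add: o_def)
  also have "?this \<longleftrightarrow> (\<lambda>x. norm (f (prime_power_point (fst x) (snd x))) * norm (f n0)) summable_on ?D"
  proof (rule summable_on_cong)
    fix x assume "x \<in> ?D"
    then obtain p \<alpha> where x: "x = (p, \<alpha>)" and p: "p \<in> ?Q" by blast
    have "replace_exponent p 0 n0 = n0"
      using replace_exponent_valuation[OF n0_pos, of p] Q(1)[OF p] by simp
    then show "norm (f (?h x)) = norm (f (prime_power_point (fst x) (snd x))) * norm (f n0)"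
      using multiplicative_replace_exponent[OF mult n0_pos Q(2)[OF p], of \<alpha>] by (simp add: x norm_mult)
  qed
  finally have "(\<lambda>x. norm (f (prime_power_point (fst x) (snd x)))) summable_on ?D"
    using n0(2) by (simp add: summable_on_cmult_left')
  then have "(\<lambda>p. norm (\<Sum>\<^sub>\<infinity>\<alpha>\<in>W p - {0}. norm (f (prime_power_point p \<alpha>)))) summable_on ?Q"
    unfolding Infinite_Sum.abs_summable_on_Sigma_iff by simp
  then have tail: "(\<lambda>p. \<Sum>\<^sub>\<infinity>\<alpha>\<in>W p - {0}. norm (f (prime_power_point p \<alpha>))) summable_on ?Q"
    by (rule abs_summable_summable)
  have "(\<lambda>p. norm (?E p - 1)) summable_on ?Q"
  proof (rule summable_on_comparison_test[OF tail])
    fix p assume p: "p \<in> ?Q"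
    have "valuation p n0 \<in> W p" using n0(1) Q(2)[OF p] unfolding exponent_box_def by blast
    then have 0: "W p = insert 0 (W p - {0})" using Q(1)[OF p] by auto
    have sm: "(\<lambda>\<alpha>. norm (f (prime_power_point p \<alpha>))) summable_on W p - {0}"
      by (rule summable_on_subset_banach[OF summable_local_factor[OF Q(2)[OF p]]]) auto
    have "?E p = f (prime_power_point p 0) + (\<Sum>\<^sub>\<infinity>\<alpha>\<in>W p - {0}. f (prime_power_point p \<alpha>))"
      by (subst 0, rule infsum_insert[OF abs_summable_summable[OF sm]]) simp
    then have "?E p - 1 = (\<Sum>\<^sub>\<infinity>\<alpha>\<in>W p - {0}. f (prime_power_point p \<alpha>))"
      by (simp add: prime_power_point_0 multiplicative_one[OF mult] del: One_nat_def)
    then show "norm (?E p - 1) \<le> (\<Sum>\<^sub>\<infinity>\<alpha>\<in>W p - {0}. norm (f (prime_power_point p \<alpha>)))"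
      using norm_infsum_bound[OF sm] by simp
  qed simp
  \<comment> \<open>The finitely many primes in the support of \<open>n0\<close> are put
    back.\<close>
  then have "(\<lambda>p. norm (?E p - 1)) summable_on (?Q \<union> prime_support n0)"
    by (rule summable_on_Un_disjoint) (auto simp: finite_prime_support[OF n0_pos])
  also have "?this \<longleftrightarrow> (\<lambda>p. norm (on_primes ?E p - 1)) summable_on UNIV"
    by (intro summable_on_cong_neutral) (auto simp: on_primes_def prime_support_def)
  finally show ?thesis
    by (simp add: abs_convergent_prod_conv_summable summable_on_imp_summable)
qed

text \<open>Partial products are sums over truncated boxes, which exhaust the box. As the limit may
  be 0, it only identifies the value; convergence in the sense of \<open>has_prod\<close> comes from
  absolute convergence.\<close>

lemma local_factors_has_prod:
  "on_primes (\<lambda>p. \<Sum>\<^sub>\<infinity>\<alpha>\<in>W p. f (prime_power_point p \<alpha>)) has_prod infsum f (exponent_box W)"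
proof -
  let ?E = "\<lambda>p. \<Sum>\<^sub>\<infinity>\<alpha>\<in>W p. f (prime_power_point p \<alpha>)"
  let ?P = "\<lambda>M. {p. prime p \<and> p \<le> M}"
  let ?B = "\<lambda>M. exponent_box (\<lambda>p. if p \<in> ?P M then W p else {0})"
  have conv: "convergent_prod (on_primes ?E)"
    by (intro abs_convergent_prod_imp_convergent_prod abs_convergent_local_factors)
  have partial: "(\<Prod>p\<le>M. on_primes ?E p) = infsum f (?B M)" for M
  proof -
    have "(\<Prod>p\<le>M. on_primes ?E p) = (\<Prod>p\<in>?P M. ?E p)"
      by (intro prod.mono_neutral_cong_right) (auto simp: on_primes_def)
    also have "\<dots> = infsum f (?B M)"
      by (rule infsum_exponent_box_finite[OF mult, symmetric]) (auto intro: summable_local_factor)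
    finally show ?thesis .
  qed
  obtain M0 where M0: "\<And>p. prime p \<Longrightarrow> p > M0 \<Longrightarrow> valuation p n0 = 0"
    by (rule valuation_zero_above[OF n0_pos]) blast
  have "(\<lambda>M. infsum f (?B M)) \<longlonglongrightarrow> infsum f (exponent_box W)"
  proof (rule infsum_exhaustion_tendsto[OF summable])
    \<comment> \<open>Beyond the last prime in the support of \<open>n0\<close>, membership of
      \<open>n0\<close> in the box shows \<open>0 \<in> W p\<close>, so truncation stays inside the
      box.\<close>
    have "?B M \<subseteq> exponent_box W" if "M \<ge> M0" for M
    proof
      fix n assume n: "n \<in> ?B M"
      have "valuation p n \<in> W p" if p: "prime p" for p
      proof (cases "p \<le> M")
        case True
        then show ?thesis using n p by (auto simp: exponent_box_def)
      next
        case False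
        then have "valuation p n0 = 0"
          using M0[of p] \<open>M \<ge> M0\<close> p by simp
        moreover have "valuation p n = 0" using n p False by (auto simp: exponent_box_def)
        moreover have "valuation p n0 \<in> W p" using n0(1) p unfolding exponent_box_def by blast
        ultimately show ?thesis by simp
      qed
      then show "n \<in> exponent_box W" using n by (simp add: exponent_box_def)
    qed
    then show "\<forall>\<^sub>F M in sequentially. ?B M \<subseteq> exponent_box W"
      by (rule eventually_sequentiallyI)
  next
    fix n assume n: "n \<in> exponent_box W"
    then have pos: "\<forall>i. n $ i > 0" by (simp add: exponent_box_def)
    obtain M1 where M1: "\<And>p. prime p \<Longrightarrow> p > M1 \<Longrightarrow> valuation p n = 0"
      by (rule valuation_zero_above[OF pos]) blast
    have "n \<in> ?B M" if "M \<ge> M1" for M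
      using in_truncated_exponent_box[OF n M1, of M] that by (auto simp: exponent_box_def)
    then show "\<forall>\<^sub>F M in sequentially. n \<in> ?B M"
      by (rule eventually_sequentiallyI)
  qed
  moreover have "(\<lambda>M. infsum f (?B M)) \<longlonglongrightarrow> prodinf (on_primes ?E)"
    using convergent_prod_LIMSEQ[OF conv] by (simp add: partial)
  ultimately have "prodinf (on_primes ?E) = infsum f (exponent_box W)"
    using LIMSEQ_unique by blast
  with conv show ?thesis by (simp add: has_prod_iff)
qed

end

section \<open>Dirichlet terms as multiplicative functions\<close>

lemma of_nat_powr_eq_exp:
  "m > 0 \<Longrightarrow> (of_nat m :: complex) powr s = exp (s * of_real (ln (real m)))"
  by (simp add: powr_def Ln_of_nat)

text \<open>Logarithms of positive integers are real and add up exactly, so no branch correction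
  enters the complex power.\<close>

lemma of_nat_prod_powr:
  assumes "finite P" "\<And>p. p \<in> P \<Longrightarrow> m p > (0::nat)"
  shows "(of_nat (\<Prod>p\<in>P. m p) :: complex) powr s = (\<Prod>p\<in>P. of_nat (m p) powr s)"
proof -
  have pos: "(\<Prod>p\<in>P. m p) > 0" using assms(2) by (intro prod_pos) auto
  have "ln (real (\<Prod>p\<in>P. m p)) = (\<Sum>p\<in>P. ln (real (m p)))"
    unfolding of_nat_prod using assms by (intro ln_prod) auto
  then have "(of_nat (\<Prod>p\<in>P. m p) :: complex) powr s = exp (\<Sum>p\<in>P. s * of_real (ln (real (m p))))"
    by (simp only: of_nat_powr_eq_exp[OF pos] of_real_sum sum_distrib_left)
  also have "\<dots> = (\<Prod>p\<in>P. of_nat (m p) powr s)"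
    using assms by (simp add: exp_sum of_nat_powr_eq_exp)
  finally show ?thesis .
qed

lemma dirichlet_term_prime_power_point:
  assumes "prime p"
  shows "dirichlet_term a s (prime_power_point p \<alpha>) = local_term a s p \<alpha>"
proof -
  have p: "p > 0" using assms by (rule prime_gt_0_nat)
  have "of_nat (p ^ k) powr z = exp (z * of_nat k * of_real (ln (real p)))" for k and z :: complex
    using p by (subst of_nat_powr_eq_exp) (auto simp: ln_realpow mult.assoc)
  then have "(\<Prod>i\<in>UNIV. of_nat (p ^ (\<alpha> $ i)) powr (s $ i)) =
      exp ((\<Sum>i\<in>UNIV. s $ i * of_nat (\<alpha> $ i)) * of_real (ln (real p)))"
    by (simp only: exp_sum[symmetric] finite_class.finite_UNIV sum_distrib_right)
  also have "\<dots> = of_nat p powr (\<Sum>i\<in>UNIV. s $ i * of_nat (\<alpha> $ i))"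
    using p by (simp add: of_nat_powr_eq_exp)
  finally show ?thesis
    by (simp add: dirichlet_term_def local_term_def prime_power_point_def)
qed

text \<open>Numerator and denominator both factor over the primes of \<open>n\<close>. The results
  on a general multiplicative \<open>f\<close> thereby apply for each fixed
  \<open>s\<close>.\<close>

lemma multiplicative_dirichlet_term:
  assumes "multiplicative a"
  shows "multiplicative (dirichlet_term a s)"
proof (rule multiplicativeI)
  show "dirichlet_term a s (\<chi> i. 1) = 1"
    using multiplicative_one[OF assms] by (simp add: dirichlet_term_def)
next
  fix n :: "nat ^ 'a" assume n: "\<forall>i. n $ i > 0"
  let ?P = "prime_support n"
  have fin: "finite ?P" by (rule finite_prime_support[OF n])
  have pos: "p ^ k > 0" if "p \<in> ?P" for p k
    using prime_gt_0_nat[OF prime_support_prime[OF that]] by simp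
  have "n $ i = (\<Prod>p\<in>?P. p ^ (valuation p n $ i))" for i
    using arg_cong[OF exponent_point_valuation[OF n], of "\<lambda>n. n $ i"]
    by (simp add: exponent_point_def prime_support_def)
  then have "of_nat (n $ i) powr (s $ i) = (\<Prod>p\<in>?P. of_nat (p ^ (valuation p n $ i)) powr (s $ i))" for i
    using of_nat_prod_powr[OF fin, of "\<lambda>p. p ^ (valuation p n $ i)" "s $ i"] pos by simp
  then have "(\<Prod>i\<in>UNIV. of_nat (n $ i) powr (s $ i)) =
      (\<Prod>p\<in>?P. \<Prod>i\<in>UNIV. of_nat (p ^ (valuation p n $ i)) powr (s $ i))"
    by (simp only: prod.swap[of _ ?P])
  moreover have "a n = (\<Prod>p\<in>?P. a (prime_power_point p (valuation p n)))"
    by (rule multiplicative_eq_prod[OF assms n fin prime_support_prime]) auto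
  ultimately show "dirichlet_term a s n =
      (\<Prod>p\<in>?P. dirichlet_term a s (prime_power_point p (valuation p n)))"
    by (simp add: dirichlet_term_def prod_dividef prime_power_point_def)
qed

lemma on_primes_euler_factor:
  "on_primes (euler_factor a s W) =
    on_primes (\<lambda>p. \<Sum>\<^sub>\<infinity>\<alpha>\<in>W p. dirichlet_term a s (prime_power_point p \<alpha>))"
  by (auto simp: on_primes_def euler_factor_def dirichlet_term_prime_power_point)

text \<open>The local sets have to be chosen before \<open>s\<close>. If \<open>a\<close> is nonzero
  at some \<open>n0\<close> of the box, then so is every \<open>dirichlet_term a s\<close>, and
  \<open>W\<close> itself serves for all \<open>s\<close>.\<close>

lemma has_euler_product_exponent_box:
  fixes a :: "nat ^ 'n \<Rightarrow> complex"
  assumes a: "multiplicative a"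
  shows "has_euler_product a (exponent_box W)"
proof (cases "\<exists>n0\<in>exponent_box W. a n0 \<noteq> 0")
  case True
  then obtain n0 where n0: "n0 \<in> exponent_box W" "a n0 \<noteq> 0" by blast
  show ?thesis
    unfolding has_euler_product_def
  proof (intro exI[of _ W] allI impI)
    fix s :: "complex ^ 'n"
    assume sm: "(\<lambda>n. norm (dirichlet_term a s n)) summable_on exponent_box W"
    have "n0 $ i > 0" for i using n0(1) by (simp add: exponent_box_def)
    then have nz: "dirichlet_term a s n0 \<noteq> 0"
      using n0(2) by (auto simp: dirichlet_term_def powr_def)
    note ctx = multiplicative_dirichlet_term[OF a, of s] n0(1) nz sm
    show "(\<forall>p. prime p \<longrightarrow> (\<lambda>\<alpha>. norm (local_term a s p \<alpha>)) summable_on W p) \<and>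
        abs_convergent_prod (on_primes (euler_factor a s W)) \<and>
        on_primes (euler_factor a s W) has_prod (\<Sum>\<^sub>\<infinity>n\<in>exponent_box W. dirichlet_term a s n)"
      using summable_local_factor[OF ctx] abs_convergent_local_factors[OF ctx]
        local_factors_has_prod[OF ctx]
      by (simp add: on_primes_euler_factor dirichlet_term_prime_power_point)
  qed
next
  case False
  \<comment> \<open>The local series over the given sets may diverge although the global series vanishes
    identically, so different local sets are needed.\<close>
  define W' :: "nat \<Rightarrow> (nat ^ 'n) set" where "W' p = (if p = 2 then {} else {0})" for p
  have E: "on_primes (euler_factor a s W') = (\<lambda>p. if p = 2 then 0 else 1)" for s
    using multiplicative_one[OF a]
    by (auto simp: fun_eq_iff on_primes_def euler_factor_def W'_def local_term_def
        prime_power_point_0 simp del: One_nat_def)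
  show ?thesis
    unfolding has_euler_product_def
  proof (intro exI[of _ W'] allI impI conjI)
    fix s :: "complex ^ 'n"
    show "(\<lambda>\<alpha>. norm (local_term a s p \<alpha>)) summable_on W' p" for p
      by (simp add: W'_def)
    have "summable (\<lambda>p. norm ((if p = 2 then 0 else 1) - 1 :: complex))"
      by (rule summable_finite[of "{2::nat}"]) auto
    then show "abs_convergent_prod (on_primes (euler_factor a s W'))"
      by (simp add: E abs_convergent_prod_conv_summable)
    have "(\<Sum>\<^sub>\<infinity>n\<in>exponent_box W. dirichlet_term a s n) = 0"
      by (rule infsum_0) (use False in \<open>auto simp: dirichlet_term_def\<close>)
    \<comment> \<open>The empty local sum at 2, an arbitrarily chosen prime, makes the product 0;
      \<open>has_prod\<close> admits finitely many zero factors.\<close>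
    then show "on_primes (euler_factor a s W') has_prod (\<Sum>\<^sub>\<infinity>n\<in>exponent_box W. dirichlet_term a s n)"
      using has_prod_single[of 2 "\<lambda>_. 0 :: complex"] by (simp add: E)
  qed
qed

section \<open>Test functions and the recovery of Property (S)\<close>

text \<open>Uniqueness of binary expansions: each sum is the code \<open>set_encode\<close> of the
  image of its index set under \<open>c\<close>.\<close>

lemma sum_distinct_powers_of_2_inject:
  assumes "inj_on c T" "A \<subseteq> T" "B \<subseteq> T" "finite A" "finite B"
    and "(\<Sum>x\<in>A. 2 ^ c x) = (\<Sum>x\<in>B. 2 ^ c x :: nat)"
  shows "A = B"
proof -
  have "(\<Sum>x\<in>X. 2 ^ c x) = set_encode (c ` X)" if "X \<subseteq> T" for X
    using inj_on_subset[OF assms(1) that] by (simp add: set_encode_def sum.reindex)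
  then have "c ` A = c ` B"
    using assms(2-6) by (simp add: set_encode_eq)
  then show ?thesis using inj_on_image_eq_iff[OF assms(1-3)] by simp
qed

lemma finite_exponent_box:
  fixes W :: "nat \<Rightarrow> (nat ^ 'n) set"
  assumes "finite P" "\<And>p. finite (W p)" "\<And>p. prime p \<Longrightarrow> p \<notin> P \<Longrightarrow> W p \<subseteq> {0}"
  shows "finite (exponent_box W)"
proof (rule finite_subset)
  let ?pt = "\<lambda>h :: nat \<Rightarrow> nat ^ 'n. exponent_point (\<lambda>p. if p \<in> P \<and> prime p then h p else 0)"
  \<comment> \<open>Inserting 0 admits the value that the choice function takes at elements of
    \<open>P\<close> that are not prime.\<close>
  show "exponent_box W \<subseteq> ?pt ` PiE P (\<lambda>p. insert 0 (W p))"
  proof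
    fix n assume n: "n \<in> exponent_box W"
    then have pos: "\<forall>i. n $ i > 0" by (simp add: exponent_box_def)
    define h where "h = restrict (\<lambda>p. if prime p then valuation p n else 0) P"
    define g where "g p = (if p \<in> P \<and> prime p then h p else 0)" for p
    have g: "g p = valuation p n" if "prime p" for p
      using n that assms(3)[of p] by (auto simp: exponent_box_def h_def g_def)
    then have "{p. prime p \<and> g p \<noteq> 0} = prime_support n"
      by (auto simp: prime_support_def)
    then have "finite_exponents g"
      using finite_prime_support[OF pos] by (simp add: finite_exponents_def)
    then have "exponent_point g = n"
      by (intro eq_of_valuations_eq[OF _ pos]) (simp_all add: exponent_point_pos valuation_exponent_point g)
    then have "?pt h = n" by (simp add: g_def[abs_def])
    moreover have "h \<in> PiE P (\<lambda>p. insert 0 (W p))"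
      using n by (auto simp: h_def exponent_box_def)
    ultimately show "n \<in> ?pt ` PiE P (\<lambda>p. insert 0 (W p))" by blast
  qed
  show "finite (?pt ` PiE P (\<lambda>p. insert 0 (W p)))"
    using assms(1,2) by (intro finite_imageI finite_PiE) auto
qed

text \<open>Testing at \<open>s = 0\<close> with a multiplicative function supported on the finitely many points that
  can be assembled from \<open>\<alpha>\<close>, \<open>\<beta>\<close> and the exponent \<open>0\<close> (forced by \<open>a(1,\<dots>,1) = 1\<close>), and taking
  pairwise distinct powers of \<open>2\<close> there: uniqueness of binary expansions recovers the index set
  from the value of the series.\<close>

lemma property_S_of_euler_products:
  fixes V :: "(real ^ 'n) set"
  assumes euler: "\<And>a. multiplicative a \<Longrightarrow> has_euler_product a (pos_points V)"
  shows "property_S V"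
  unfolding property_S_def
proof (intro allI impI, elim conjE)
  fix \<alpha> \<beta> \<gamma> :: "nat \<Rightarrow> nat ^ 'n"
  let ?N = "pos_points V"
  assume fin: "finite_exponents \<alpha>" "finite_exponents \<beta>"
    and N: "exponent_point \<alpha> \<in> ?N" "exponent_point \<beta> \<in> ?N"
    and \<gamma>: "\<forall>p. prime p \<longrightarrow> \<gamma> p \<in> {\<alpha> p, \<beta> p}"
  define P where "P = {p. prime p \<and> \<alpha> p \<noteq> 0} \<union> {p. prime p \<and> \<beta> p \<noteq> 0}"
  have finP: "finite P" using fin by (simp add: P_def finite_exponents_def)
  have fin_sub: "finite_exponents \<delta>" if "\<And>p. prime p \<Longrightarrow> \<delta> p \<in> {0, \<alpha> p, \<beta> p}" for \<delta>
  proof -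
    have "p \<in> P" if "prime p" "\<delta> p \<noteq> 0" for p
      using \<open>prime p \<Longrightarrow> \<delta> p \<in> {0, \<alpha> p, \<beta> p}\<close> that by (auto simp: P_def)
    then have "{p. prime p \<and> \<delta> p \<noteq> 0} \<subseteq> P" by blast
    then show ?thesis unfolding finite_exponents_def using finP finite_subset by blast
  qed
  define T where "T = exponent_box (\<lambda>p. {0, \<alpha> p, \<beta> p})"
  have finT: "finite T"
    unfolding T_def by (rule finite_exponent_box[OF finP]) (auto simp: P_def)
  have point_T: "exponent_point \<delta> \<in> T" if "\<And>p. prime p \<Longrightarrow> \<delta> p \<in> {0, \<alpha> p, \<beta> p}" for \<delta>
    using that fin_sub[OF that] unfolding T_def exponent_box_def
    by (simp add: exponent_point_pos valuation_exponent_point)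

  \<comment> \<open>A numbering of the pairs of a prime and an exponent tuple;
    \<open>vec_nth\<close> turns the tuple into a function on a finite type, which is
    countable.\<close>
  define g :: "nat \<Rightarrow> nat ^ 'n \<Rightarrow> nat" where "g p \<delta> = to_nat (p, vec_nth \<delta>)" for p \<delta>
  have g_inj: "g p \<delta> = g q \<epsilon> \<longleftrightarrow> p = q \<and> \<delta> = \<epsilon>" for p q \<delta> \<epsilon>
    by (simp add: g_def vec_nth_inject)
  \<comment> \<open>The double exponential turns a product over primes into 2 to the power of a sum
    of distinct powers of 2. The case 0 comes first since \<open>\<alpha> p\<close> or
    \<open>\<beta> p\<close> may be 0, where the value has to be 1.\<close>
  define b :: "nat \<Rightarrow> nat ^ 'n \<Rightarrow> complex"
    where "b p \<delta> = (if \<delta> = 0 then 1 else if \<delta> \<in> {\<alpha> p, \<beta> p} then 2 ^ (2 ^ g p \<delta>) else 0)" for p \<delta>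
  define a where "a = (\<lambda>n. \<Prod>p\<in>prime_support n. b p (valuation p n))"
  have b0: "b p 0 = 1" for p by (simp add: b_def)
  have mult: "multiplicative a" and a_pp: "\<And>p \<delta>. prime p \<Longrightarrow> a (prime_power_point p \<delta>) = b p \<delta>"
    unfolding a_def using multiplicative_prod_prime_support[of b] b0 by auto
  define c where "c n = set_encode ((\<lambda>p. g p (valuation p n)) ` prime_support n)" for n
  have a_T: "a n = of_nat (2 ^ c n)" if "n \<in> T" for n
  proof -
    have "a n = (\<Prod>p\<in>prime_support n. 2 ^ (2 ^ g p (valuation p n)))"
      unfolding a_def
      by (intro prod.cong refl)
         (use that in \<open>auto simp: b_def T_def exponent_box_def prime_support_def\<close>)
    also have "\<dots> = 2 ^ (\<Sum>p\<in>prime_support n. 2 ^ g p (valuation p n))"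
      by (simp add: power_sum)
    also have "(\<Sum>p\<in>prime_support n. 2 ^ g p (valuation p n)) = c n"
      unfolding c_def set_encode_def by (subst sum.reindex) (auto simp: inj_on_def g_inj)
    finally show ?thesis by simp
  qed
  have a_nT: "a n = 0" if n: "\<forall>i. n $ i > 0" "n \<notin> T" for n
  proof -
    obtain p where "prime p" "valuation p n \<notin> {0, \<alpha> p, \<beta> p}"
      using n unfolding T_def exponent_box_def by blast
    then have "p \<in> prime_support n" "b p (valuation p n) = 0"
      by (auto simp: prime_support_def b_def)
    then show ?thesis
      using finite_prime_support[OF n(1)] unfolding a_def by (auto intro: prod_zero)
  qed
  \<comment> \<open>The code \<open>c n\<close> determines the set of primes in the support of
    \<open>n\<close> together with their exponents, hence \<open>n\<close>.\<close>
  have c_inj: "inj_on c T"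
  proof (rule inj_onI)
    fix m n assume m: "m \<in> T" and n: "n \<in> T" and eq: "c m = c n"
    have pos: "\<forall>i. m $ i > 0" "\<forall>i. n $ i > 0" using m n by (auto simp: T_def exponent_box_def)
    have img: "(\<lambda>p. g p (valuation p m)) ` prime_support m = (\<lambda>p. g p (valuation p n)) ` prime_support n"
      using eq finite_prime_support[OF pos(1)] finite_prime_support[OF pos(2)]
      unfolding c_def by (simp add: set_encode_eq)
    show "m = n"
    proof (rule eq_of_valuations_eq[OF pos])
      fix p :: nat assume p: "prime p"
      have "valuation p m = valuation p n" if "p \<in> prime_support m"
      proof -
        have "g p (valuation p m) \<in> (\<lambda>p. g p (valuation p n)) ` prime_support n"
          using that unfolding img[symmetric] by (rule imageI)
        then show ?thesis by (auto simp: g_inj)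
      qed
      moreover have "valuation p m = valuation p n" if "p \<in> prime_support n"
      proof -
        have "g p (valuation p n) \<in> (\<lambda>p. g p (valuation p m)) ` prime_support m"
          using that unfolding img by (rule imageI)
        then show ?thesis by (auto simp: g_inj)
      qed
      ultimately show "valuation p m = valuation p n"
        using p unfolding prime_support_def by (cases "valuation p m = 0"; cases "valuation p n = 0") auto
    qed
  qed

  \<comment> \<open>Since \<open>a\<close> vanishes off the finite set \<open>T\<close>, the sum
    over \<open>X\<close> is a natural number whose binary digits record
    \<open>X \<inter> T\<close>.\<close>
  have infsum_a: "(\<lambda>n. norm (a n)) summable_on X" "infsum a X = of_nat (\<Sum>n\<in>X \<inter> T. 2 ^ c n)"
    if "\<And>n. n \<in> X \<Longrightarrow> \<forall>i. n $ i > 0" for X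
  proof -
    have "{n \<in> X. norm (a n) \<noteq> 0} \<subseteq> T" using a_nT that by auto
    then show "(\<lambda>n. norm (a n)) summable_on X"
      by (intro finite_nonzero_values_imp_summable_on finite_subset[OF _ finT])
    have "infsum a X = infsum a (X \<inter> T)"
      by (rule infsum_cong_neutral) (use a_nT that in auto)
    also have "\<dots> = (\<Sum>n\<in>X \<inter> T. a n)" using finT by simp
    also have "\<dots> = of_nat (\<Sum>n\<in>X \<inter> T. 2 ^ c n)" by (simp add: a_T)
    finally show "infsum a X = of_nat (\<Sum>n\<in>X \<inter> T. 2 ^ c n)" .
  qed
  have posN: "\<forall>i. n $ i > 0" if "n \<in> ?N" for n using that by (simp add: pos_points_def)
  have infsum_N: "infsum a ?N = of_nat (\<Sum>n\<in>?N \<inter> T. 2 ^ c n)"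
    by (rule infsum_a(2)[OF posN])
  \<comment> \<open>Positivity of the coordinates matters because
    \<open>0 powr 0 = 0\<close>.\<close>
  have term_0: "dirichlet_term a 0 n = a n" if "\<forall>i. n $ i > 0" for n
  proof -
    have "of_nat (n $ i) powr ((0 :: complex ^ 'n) $ i) = (1 :: complex)" for i
      using that[rule_format, of i] by simp
    then show ?thesis by (simp only: dirichlet_term_def prod.neutral_const div_by_1)
  qed

  obtain W where W: "\<And>s. (\<lambda>n. norm (dirichlet_term a s n)) summable_on ?N \<Longrightarrow>
      on_primes (euler_factor a s W) has_prod (\<Sum>\<^sub>\<infinity>n\<in>?N. dirichlet_term a s n)"
    using euler[OF mult] unfolding has_euler_product_def by blast
  define E where "E p = (\<Sum>\<^sub>\<infinity>\<delta>\<in>W p. a (prime_power_point p \<delta>))" for p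
  have "on_primes (euler_factor a 0 W) = on_primes E"
    unfolding on_primes_euler_factor unfolding on_primes_def E_def
    by (auto simp: fun_eq_iff term_0 prime_power_point_pos)
  moreover have "(\<lambda>n. norm (dirichlet_term a 0 n)) summable_on ?N"
    using infsum_a(1)[OF posN] by (simp add: term_0 posN cong: summable_on_cong)
  moreover have "(\<Sum>\<^sub>\<infinity>n\<in>?N. dirichlet_term a 0 n) = infsum a ?N"
    by (intro infsum_cong term_0 posN)
  ultimately have prodN: "on_primes E has_prod infsum a ?N" using W[of 0] by simp

  have \<alpha>T: "exponent_point \<alpha> \<in> T" and \<beta>T: "exponent_point \<beta> \<in> T" and \<gamma>T: "exponent_point \<gamma> \<in> T"
    by (rule point_T; use \<gamma> in auto)+
  \<comment> \<open>The term at \<open>exponent_point \<alpha>\<close> is positive. A nonzero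
    product has no zero factor, so every \<open>W p\<close> contains an exponent at which
    \<open>b p\<close> is nonzero; these exponents assemble to a point of the box where
    \<open>a\<close> does not vanish.\<close>
  have "(\<Sum>n\<in>?N \<inter> T. 2 ^ c n) \<noteq> (0::nat)"
    using N(1) \<alpha>T finT by auto
  then have "infsum a ?N \<noteq> 0" unfolding infsum_N of_nat_eq_0_iff .
  then have E_nz: "E p \<noteq> 0" if "prime p" for p
    using has_prod_zeroI[OF prodN, of p] that by (auto simp: on_primes_def)
  have "\<exists>\<delta>\<in>W p. b p \<delta> \<noteq> 0" if "prime p" for p
    using E_nz[OF that] infsum_0[of "W p" "\<lambda>\<delta>. a (prime_power_point p \<delta>)"]
    unfolding E_def a_pp[OF that] by blast
  then obtain \<delta> where \<delta>: "\<And>p. prime p \<Longrightarrow> \<delta> p \<in> W p" "\<And>p. prime p \<Longrightarrow> b p (\<delta> p) \<noteq> 0"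
    by metis
  have \<delta>': "\<delta> p \<in> {0, \<alpha> p, \<beta> p}" if "prime p" for p
    using \<delta>(2)[OF that] by (auto simp: b_def split: if_splits)
  have n0: "exponent_point \<delta> \<in> exponent_box W"
    using \<delta>(1) fin_sub[OF \<delta>'] by (simp add: exponent_box_def exponent_point_pos valuation_exponent_point)
  have a_n0: "a (exponent_point \<delta>) \<noteq> 0"
    using a_T[OF point_T[OF \<delta>']] by simp
  have posW: "\<forall>i. n $ i > 0" if "n \<in> exponent_box W" for n using that by (simp add: exponent_box_def)
  \<comment> \<open>The same Euler product is now evaluated as the sum over the box of
    \<open>W\<close>. Comparing the two values and reading off binary digits shows that
    \<open>?N\<close> and the box agree on \<open>T\<close>, which contains all three points in
    question.\<close>
  have "on_primes E has_prod infsum a (exponent_box W)"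
    using local_factors_has_prod[OF mult n0 a_n0 infsum_a(1)[OF posW]] unfolding E_def .
  then have eq_infsum: "infsum a ?N = infsum a (exponent_box W)"
    using prodN has_prod_unique2 by blast
  have infsum_W: "infsum a (exponent_box W) = of_nat (\<Sum>n\<in>exponent_box W \<inter> T. 2 ^ c n)"
    by (rule infsum_a(2)[OF posW])
  from eq_infsum have "(\<Sum>n\<in>?N \<inter> T. 2 ^ c n) = (\<Sum>n\<in>exponent_box W \<inter> T. 2 ^ c n :: nat)"
    unfolding infsum_N infsum_W of_nat_eq_iff .
  then have eq: "?N \<inter> T = exponent_box W \<inter> T"
    using finT by (intro sum_distinct_powers_of_2_inject[OF c_inj]) auto
  have "exponent_point \<alpha> \<in> exponent_box W" "exponent_point \<beta> \<in> exponent_box W"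
    using eq N \<alpha>T \<beta>T by blast+
  then have \<alpha>\<beta>W: "\<alpha> p \<in> W p" "\<beta> p \<in> W p" if "prime p" for p
    using that fin by (simp_all add: exponent_box_def valuation_exponent_point)
  have "\<gamma> p \<in> W p" if "prime p" for p
    using \<gamma>[rule_format, OF that] \<alpha>\<beta>W[OF that] by auto
  moreover have "finite_exponents \<gamma>" by (rule fin_sub) (use \<gamma> in auto)
  ultimately have "exponent_point \<gamma> \<in> exponent_box W"
    by (simp add: exponent_box_def exponent_point_pos valuation_exponent_point)
  with eq \<gamma>T show "exponent_point \<gamma> \<in> ?N" by blast
qed

text \<open>The identity is read in two senses, analytically wherever the series converges
  absolutely and formally on coefficients; each sense separately is equivalent to (S).\<close>

theorem theorem2p1:
  fixes fs :: "'n::finite ratfun list"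
  assumes "length fs \<le> CARD('n)"
    and "\<forall>(P, Q)\<in>set fs. Q \<noteq> 0"
  shows "((\<forall>a :: nat ^ 'n \<Rightarrow> complex. multiplicative a \<longrightarrow>
             has_euler_product a (pos_points (variety fs)))
           \<longleftrightarrow> property_S (variety fs)) \<and>
         ((\<forall>a :: nat ^ 'n \<Rightarrow> complex. multiplicative a \<longrightarrow>
             has_formal_euler_product a (pos_points (variety fs)))
           \<longleftrightarrow> property_S (variety fs))"
proof (intro conjI iffI allI impI)
  assume "\<forall>a :: nat ^ 'n \<Rightarrow> complex. multiplicative a \<longrightarrow> has_euler_product a (pos_points (variety fs))"
  then show "property_S (variety fs)" by (intro property_S_of_euler_products) blast
next
  assume "\<forall>a :: nat ^ 'n \<Rightarrow> complex. multiplicative a \<longrightarrow>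
    has_formal_euler_product a (pos_points (variety fs))"
  then have "\<exists>W. pos_points (variety fs) = exponent_box W"
    using multiplicative_const_1
    by (intro exponent_box_of_formal_euler_product) (auto simp: pos_points_def)
  then show "property_S (variety fs)" by (simp add: property_S_iff_exponent_box)
next
  fix a :: "nat ^ 'n \<Rightarrow> complex"
  assume "property_S (variety fs)" and a: "multiplicative a"
  then obtain W where "pos_points (variety fs) = exponent_box W"
    using property_S_iff_exponent_box by blast
  with a show "has_euler_product a (pos_points (variety fs))"
    "has_formal_euler_product a (pos_points (variety fs))"
    by (simp_all add: has_euler_product_exponent_box has_formal_euler_product_exponent_box)
qed

end
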